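(* $Z_{\mathrm{WMDS}}(s_1,s_2,w)$ is a quadratic $A_3$ Weyl group multiple Dirichlet series; that is, for every prime $p$, the generating function of its $p$-part coefficients satisfies $$\sum_{k,l,t\ge0} a(p^k,p^l,p^t)\,x^l y^k z^t=f_{A_3}(x,y,z)$$ (as power series, e.g. for $|x|,|y|,|z|<1/p$), where $$f_{A_3}(x,y,z)=\frac{1-xy-yz+xyz+pxy^2z-px^2y^2z-pxy^2z^2+px^2y^3z^2}{(1-x)(1-y)(1-z)(1-py^2z^2)(1-py^2x^2)(1-p^2x^2y^2z^2)}.$$
   Context: $Z_{\mathrm{WMDS}}(s_1,s_2,w)=\sum_{D}|D|^{-w}\sum_{m,n>0}\chi_D(\hat m)\chi_D(\hat n)\,a(D,m,n)\,m^{-s_1}n^{-s_2}$, $D$ running over odd nonzero integers $\equiv1\pmod4$; here $\chi_D$ is the quadratic character of $\mathbb{Q}(\sqrt D)/\mathbb{Q}$ and $\hat m$ is the largest factor of $m$ coprime to the square-free part of $D$. For $D\neq0$, $m>0$: $a(D,m)=\prod_p a(p^k,p^l)$ with $p^k\|D$, $p^l\|m$, $a(p^k,p^l)=\min(p^{k/2},p^{l/2})$ if $\min(k,l)$ is even, $0$ otherwise. Writing $D=D_0D_1^2$ ($D_0$ square-free, $D_1>0$), $a(D,m,n)=\sum_{d>0,\,d\mid D_1,\,d\mid m,\,d\mid n} d\,a(D/d^2,m/d)\,a(D/d^2,n/d)$; thus $a(p^k,p^l,p^t)=\sum_{s\ge0,\ 2s\le k,\ s\le l,\ s\le t} p^s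 a(p^{k-2s},p^{l-s})a(p^{k-2s},p^{t-s})$. A quadratic $A_3$ Weyl group multiple Dirichlet series (in the sense of Chinta–Gunnells) is one whose $p$-part coefficients have generating function the Weyl-group-invariant rational function $f_{A_3}$ displayed in the claim. *)

theory Defs
  imports
    "HOL-Analysis.Analysis"
    "HOL-Computational_Algebra.Squarefree"
    "HOL-Number_Theory.Number_Theory"
begin

text \<open>
  Throughout, \<open>D = D\<^sub>0 D\<^sub>1\<^sup>2\<close> with \<open>D\<^sub>0\<close> square-free (carrying the sign of \<open>D\<close>) and \<open>D\<^sub>1 > 0\<close>.
  Here \<open>D\<^sub>0\<close> is \<^const>\<open>squarefree_part\<close> and \<open>D\<^sub>1\<close> is \<^const>\<open>square_part\<close>.
\<close>

subsection \<open>The quadratic character of \<open>\<rat>(\<surd>D)\<close>\<close>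

definition field_disc :: "int \<Rightarrow> int" where
  "field_disc D =
     (if squarefree_part D mod 4 = 1 then squarefree_part D else 4 * squarefree_part D)"

text \<open>
  The value at a prime is \<open>1\<close>, \<open>-1\<close> or \<open>0\<close> according to whether the prime splits, is inert or
  ramifies; this is the Kronecker symbol of the field discriminant. For \<open>D\<close> a square the
  character is trivial.
\<close>

definition quad_char_prime :: "int \<Rightarrow> nat \<Rightarrow> int" where
  "quad_char_prime D p =
     (if p = 2 then
        (if even (field_disc D) then 0 else if field_disc D mod 8 = 1 then 1 else -1)
      else Legendre (field_disc D) (int p))"

definition quad_char :: "int \<Rightarrow> nat \<Rightarrow> int" where
  "quad_char D n = (\<Prod>p\<in>prime_factors n. quad_char_prime D p ^ multiplicity p n)"

definition hat :: "int \<Rightarrow> nat \<Rightarrow> nat" where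
  "hat D m = Max {d. d dvd m \<and> coprime (int d) (squarefree_part D)}"

subsection \<open>The coefficients\<close>

definition coeff_pp :: "nat \<Rightarrow> nat \<Rightarrow> nat \<Rightarrow> real" where
  "coeff_pp p k l =
     (if even (min k l) then min (real p powr (real k / 2)) (real p powr (real l / 2)) else 0)"

text \<open>
  The product over all primes is restricted to the primes dividing \<open>D m\<close>; every other factor
  is \<^term>\<open>coeff_pp p 0 0 = 1\<close>.
\<close>

definition coeff2 :: "int \<Rightarrow> nat \<Rightarrow> real" where
  "coeff2 D m =
     (\<Prod>p\<in>prime_factors (nat \<bar>D\<bar> * m). coeff_pp p (multiplicity (int p) D) (multiplicity p m))"

definition coeff3 :: "int \<Rightarrow> nat \<Rightarrow> nat \<Rightarrow> real" where
  "coeff3 D m n =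
     (\<Sum>d\<in>{d. 0 < d \<and> int d dvd square_part D \<and> d dvd m \<and> d dvd n}.
        real d * coeff2 (D div (int d)\<^sup>2) (m div d) * coeff2 (D div (int d)\<^sup>2) (n div d))"

subsection \<open>The multiple Dirichlet series\<close>

text \<open>
  The quadratic double-twisted series attached to an array of coefficients \<open>c D m n\<close>. As usual
  for \<^const>\<open>infsum\<close>, the value is meaningful where the sums converge. The condition
  \<open>D mod 4 = 1\<close> (for negative \<open>D\<close> as well) already makes \<open>D\<close> odd and nonzero.
\<close>

definition quadratic_MDS ::
    "(int \<Rightarrow> nat \<Rightarrow> nat \<Rightarrow> real) \<Rightarrow> complex \<Rightarrow> complex \<Rightarrow> complex \<Rightarrow> complex" where
  "quadratic_MDS c s1 s2 w =
     (\<Sum>\<^sub>\<infinity>D\<in>{D::int. D mod 4 = 1}. of_int \<bar>D\<bar> powr (-w) *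
        (\<Sum>\<^sub>\<infinity>(m, n)\<in>{0<..} \<times> {0<..}.
           of_int (quad_char D (hat D m)) * of_int (quad_char D (hat D n)) *
           of_real (c D m n) * of_nat m powr (-s1) * of_nat n powr (-s2)))"

definition Z_WMDS :: "complex \<Rightarrow> complex \<Rightarrow> complex \<Rightarrow> complex" where
  "Z_WMDS = quadratic_MDS coeff3"

definition f_A3 :: "nat \<Rightarrow> complex \<Rightarrow> complex \<Rightarrow> complex \<Rightarrow> complex" where
  "f_A3 q x y z = (let p = of_nat q in
     (1 - x * y - y * z + x * y * z + p * x * y^2 * z - p * x^2 * y^2 * z - p * x * y^2 * z^2
        + p * x^2 * y^3 * z^2) /
     ((1 - x) * (1 - y) * (1 - z) * (1 - p * y^2 * z^2) * (1 - p * y^2 * x^2)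
        * (1 - p^2 * x^2 * y^2 * z^2)))"

text \<open>
  \<open>Z\<close> is a quadratic \<open>A\<^sub>3\<close> Weyl group multiple Dirichlet series with coefficients \<open>c\<close>: for
  each prime \<open>p\<close> the generating function of the \<open>p\<close>-part is \<^const>\<open>f_A3\<close>. The identity of
  power series is stated as an absolutely convergent sum on the polydisc of radius \<open>1/p\<close>.
  The variable \<open>y\<close> marks the exponent of \<open>D\<close>, and \<open>x\<close>, \<open>z\<close> those of \<open>m\<close>, \<open>n\<close>.
\<close>

definition is_quadratic_A3_WMDS ::
    "(complex \<Rightarrow> complex \<Rightarrow> complex \<Rightarrow> complex) \<Rightarrow> (int \<Rightarrow> nat \<Rightarrow> nat \<Rightarrow> real) \<Rightarrow> bool" where
  "is_quadratic_A3_WMDS Z c \<longleftrightarrow>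
     Z = quadratic_MDS c \<and>
     (\<forall>p::nat. prime p \<longrightarrow>
        (\<forall>x y z. norm x < 1 / real p \<longrightarrow> norm y < 1 / real p \<longrightarrow> norm z < 1 / real p \<longrightarrow>
           ((\<lambda>(k, l, t). of_real (c (int p ^ k) (p ^ l) (p ^ t)) * x ^ l * y ^ k * z ^ t)
              has_sum f_A3 p x y z) UNIV))"

end

(* The divisor sum in coeff3 splits off the factor 1 / (1 - p x y^2 z), leaving the series
   H = sum_k A_k(x) A_k(z) y^k, where A_k(x) = sum_l a(p^k, p^l) x^l.  The rows satisfy
   A_0 = 1 / (1 - x), A_1 = 1 and A_(k+2) = 1 + p x^2 A_k, so both sum_k A_k(x) y^k and H are
   determined by linear equations obtained from shifting k by two. *)
theory Submission
  imports Defs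
begin

section \<open>The coefficients at prime powers\<close>

lemma coeff_pp_0_left [simp]: "p > 0 \<Longrightarrow> coeff_pp p 0 l = 1"
  by (auto simp: coeff_pp_def intro!: min_absorb1 ge_one_powr_ge_zero)

lemma coeff_pp_0_right [simp]: "p > 0 \<Longrightarrow> coeff_pp p k 0 = 1"
  by (auto simp: coeff_pp_def intro!: min_absorb2 ge_one_powr_ge_zero)

lemma coeff_pp_1_Suc [simp]: "coeff_pp p (Suc 0) (Suc l) = 0"
  by (simp add: coeff_pp_def)

lemma coeff_pp_Suc_1 [simp]: "coeff_pp p (Suc k) (Suc 0) = 0"
  by (simp add: coeff_pp_def)

text \<open>Raising both exponents by two keeps the parity of the minimum and multiplies both square
  roots by \<open>p\<close>. This is the source of every recursion below.\<close>

lemma coeff_pp_Suc_Suc: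
  assumes "p > 0"
  shows "coeff_pp p (Suc (Suc k)) (Suc (Suc l)) = real p * coeff_pp p k l"
proof -
  have "real p powr (real (Suc (Suc j)) / 2) = real p * real p powr (real j / 2)" for j
    using assms by (simp add: powr_add add_divide_distrib)
  then show ?thesis
    by (simp add: coeff_pp_def min_mult_distrib_left)
qed

lemma coeff_pp_nonneg: "coeff_pp p k l \<ge> 0"
  by (simp add: coeff_pp_def)

text \<open>A crude bound that is uniform in \<open>k\<close>; it lets every row be compared with
  the geometric series in \<open>p * x\<close>, whence the radius 1/p.\<close>

lemma coeff_pp_le_power:
  assumes "p > 0"
  shows "coeff_pp p k l \<le> real p ^ l"
proof -
  have "coeff_pp p k l \<le> real p powr (real l / 2)"
    by (simp add: coeff_pp_def)
  also have "\<dots> \<le> real p powr real l"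
    using assms by (intro powr_mono) auto
  finally show ?thesis
    using assms by (simp add: powr_realpow)
qed

lemma coeff2_prime_power:
  assumes "prime p"
  shows "coeff2 (int p ^ k) (p ^ l) = coeff_pp p k l"
proof -
  have p: "p > 0" "prime (int p)"
    using assms by (auto simp: prime_gt_0_nat)
  have "nat \<bar>int p ^ k\<bar> * p ^ l = p ^ (k + l)"
    by (simp add: nat_power_eq power_add)
  \<comment> \<open>For \<open>k + l = 0\<close> the product is empty, which agrees with
    \<open>coeff_pp p 0 0 = 1\<close>.\<close>
  moreover have "prime_factors (p ^ (k + l)) = (if k + l = 0 then {} else {p})"
    using assms by (auto simp: prime_factors_power prime_prime_factors)
  moreover have "multiplicity (int p) (int p ^ k) = k" "multiplicity p (p ^ l) = l"
    using p assms by (auto intro!: multiplicity_same_power)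
  ultimately show ?thesis
    using p by (auto simp: coeff2_def)
qed

text \<open>A number divides the square part exactly when its square divides the whole, so only the
  exponents 2s and k have to be compared.\<close>

lemma dvd_square_part_prime_power_iff:
  assumes "prime p"
  shows "int (p ^ s) dvd square_part (int p ^ k) \<longleftrightarrow> 2 * s \<le> k"
proof -
  have "int (p ^ s) dvd square_part (int p ^ k) \<longleftrightarrow> int p ^ (2 * s) dvd int p ^ k"
    by (simp add: dvd_square_part_iff mult.commute[of s] flip: power_mult)
  also have "\<dots> \<longleftrightarrow> 2 * s \<le> k"
    using assms prime_gt_1_nat[OF assms] by (simp add: dvd_power_iff_le flip: of_nat_power)
  finally show ?thesis .
qed

text \<open>The admissible divisors are exactly the powers \<open>p ^ s\<close> with
  \<open>s\<close> in \<open>?S\<close>, and all quotients in the summand are again powers of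
  \<open>p\<close>.\<close>

lemma coeff3_prime_power:
  assumes "prime p"
  shows "coeff3 (int p ^ k) (p ^ l) (p ^ t) =
    (\<Sum>s | 2 * s \<le> k \<and> s \<le> l \<and> s \<le> t.
       real p ^ s * coeff_pp p (k - 2 * s) (l - s) * coeff_pp p (k - 2 * s) (t - s))"
proof -
  let ?S = "{s. 2 * s \<le> k \<and> s \<le> l \<and> s \<le> t}"
  have p: "p > 0" "p > 1"
    using assms prime_gt_0_nat prime_gt_1_nat by blast+
  have dvd: "p ^ s dvd p ^ n \<longleftrightarrow> s \<le> n" for s n
    using p by (simp add: dvd_power_iff_le)
  have "{d. 0 < d \<and> int d dvd square_part (int p ^ k) \<and> d dvd p ^ l \<and> d dvd p ^ t} =
      (\<lambda>s. p ^ s) ` ?S" (is "?D = _")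
  proof (intro equalityI subsetI)
    fix d assume d: "d \<in> ?D"
    then obtain s where "d = p ^ s"
      using assms by (auto simp: divides_primepow_nat)
    with d show "d \<in> (\<lambda>s. p ^ s) ` ?S"
      using assms dvd dvd_square_part_prime_power_iff[OF assms] by auto
  qed (use p dvd dvd_square_part_prime_power_iff[OF assms] in auto)
  moreover have "inj_on (\<lambda>s. p ^ s) ?S"
    using p by (auto simp: inj_on_def)
  moreover have "int p ^ k div (int (p ^ s))\<^sup>2 = int p ^ (k - 2 * s)" if "2 * s \<le> k" for s
    using p that by (simp add: power_diff mult.commute[of s] flip: power_mult)
  moreover have "p ^ n div p ^ s = p ^ (n - s)" if "s \<le> n" for n s
    using p that by (simp add: power_diff)
  ultimately show ?thesis
    unfolding coeff3_def
    \<comment> \<open>\<open>of_nat_power\<close> is held back so that \<open>int (p ^ s)\<close>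
      keeps the shape in which the quotient fact is stated.\<close>
    by (simp add: sum.reindex coeff2_prime_power[OF assms] del: of_nat_power)
       (simp add: of_nat_power)
qed

section \<open>Unconditional sums\<close>

text \<open>Unconditional and absolute summability coincide for complex-valued families.\<close>

lemma has_sum_complex_imp_norm_summable:
  fixes f :: "'a \<Rightarrow> complex"
  assumes "(f has_sum S) A"
  shows "(\<lambda>x. norm (f x)) summable_on A"
  using has_sum_imp_summable[OF assms]
  by (simp only: summable_on_iff_abs_summable_on_complex)

text \<open>Summing over \<open>j\<close> first and then over \<open>i\<close> yields
  \<open>F * G\<close>; summability on the product set comes from the same iteration applied to the
  norms.\<close>

lemma has_sum_times_complex:
  fixes f :: "'a \<Rightarrow> complex" and g :: "'b \<Rightarrow> complex"
  assumes f: "(f has_sum F) A" and g: "(g has_sum G) B"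
  shows "((\<lambda>(i, j). f i * g j) has_sum F * G) (A \<times> B)"
proof (rule has_sum_SigmaI)
  show "((\<lambda>j. case (i, j) of (i, j) \<Rightarrow> f i * g j) has_sum f i * G) B" for i
    using has_sum_cmult_right[OF g] by simp
  show "((\<lambda>i. f i * G) has_sum F * G) A"
    by (rule has_sum_cmult_left[OF f])
  have "(\<lambda>i. norm (f i)) summable_on A" "(\<lambda>j. norm (g j)) summable_on B"
    using f g by (auto intro: has_sum_complex_imp_norm_summable)
  then have "(\<lambda>x. norm (case x of (i, j) \<Rightarrow> f i * g j)) summable_on A \<times> B"
    by (intro summable_on_SigmaI[where g = "\<lambda>i. norm (f i) * infsum (\<lambda>j. norm (g j)) B"])
       (simp_all add: norm_mult has_sum_cmult_right summable_on_cmult_left)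
  then show "(\<lambda>(i, j). f i * g j) summable_on A \<times> B"
    by (rule abs_summable_summable)
qed

lemma has_sum_geometric_complex:
  fixes z :: complex
  assumes "norm z < 1"
  shows "((\<lambda>n. z ^ n) has_sum 1 / (1 - z)) UNIV"
  using assms
  by (intro norm_summable_imp_has_sum geometric_sums) (simp add: norm_power summable_geometric)

text \<open>Peels off two initial terms, because the recursions in \<open>k\<close> and in
  \<open>l\<close> both have step two.\<close>

lemma has_sum_nat_split2:
  fixes f :: "nat \<Rightarrow> complex"
  assumes "((\<lambda>n. f (Suc (Suc n))) has_sum S) UNIV"
  shows "(f has_sum (f 0 + f 1 + S)) UNIV"
proof -
  have "((\<lambda>n. f (n + 2)) has_sum S) UNIV"
    using assms by simp
  also have "?this \<longleftrightarrow> (f has_sum S) {2..}"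
    by (rule has_sum_reindex_bij_witness[where i = "\<lambda>n. n - 2" and j = "\<lambda>n. n + 2"]) auto
  finally have "(f has_sum (f 0 + (f 1 + S))) (insert 0 (insert 1 {2..}))"
    by (intro has_sum_insert) auto
  moreover have "insert 0 (insert 1 {2..}) = (UNIV :: nat set)"
    by auto
  ultimately show ?thesis
    by (simp only: add.assoc)
qed

section \<open>The generating functions\<close>

text \<open>The series A_k(x). Being an \<open>infsum\<close>, it would be 0 by default without
  convergence, so its value carries information only through \<open>has_sum_row\<close>.\<close>

definition row :: "nat \<Rightarrow> complex \<Rightarrow> nat \<Rightarrow> complex" where
  "row p x k = (\<Sum>\<^sub>\<infinity>l. of_real (coeff_pp p k l) * x ^ l)"

lemma norm_coeff_pp_power_le:
  assumes "p > 0"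
  shows "norm (of_real (coeff_pp p k l) * x ^ l :: complex) \<le> norm ((of_nat p * x) ^ l)"
  using coeff_pp_le_power[OF assms, of k l] coeff_pp_nonneg[of p k l]
  by (simp add: norm_mult norm_power power_mult_distrib mult_right_mono)

context
  fixes p :: nat and x :: complex
  assumes p: "p > 0" and x: "norm (of_nat p * x) < 1"
begin

lemma norm_less_1: "norm x < 1"
proof -
  have "norm x \<le> norm (of_nat p * x)"
    using p by (simp add: norm_mult mult_le_cancel_right1)
  with x show ?thesis by simp
qed

lemma has_sum_row: "((\<lambda>l. of_real (coeff_pp p k l) * x ^ l) has_sum row p x k) UNIV"
proof -
  have "(\<lambda>l. norm (of_real (coeff_pp p k l) * x ^ l)) summable_on UNIV"
    by (rule Infinite_Sum.abs_summable_on_comparison_test'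
        [OF has_sum_complex_imp_norm_summable[OF has_sum_geometric_complex[OF x]]])
       (rule norm_coeff_pp_power_le[OF p])
  then show ?thesis
    unfolding row_def by (rule has_sum_infsum[OF abs_summable_summable])
qed

lemma row_0: "row p x 0 = 1 / (1 - x)"
proof (rule has_sum_unique)
  show "((\<lambda>l. x ^ l) has_sum row p x 0) UNIV"
    using has_sum_row[of 0] p by simp
qed (intro has_sum_geometric_complex norm_less_1)

text \<open>The minimum of 1 and \<open>l\<close> is odd for all l \<ge> 1, so only the constant
  term survives.\<close>

lemma row_1: "row p x (Suc 0) = 1"
proof (rule has_sum_unique)
  show "((\<lambda>l. of_real (coeff_pp p (Suc 0) l) * x ^ l) has_sum 1) UNIV"
    using has_sum_nat_split2[of "\<lambda>l. of_real (coeff_pp p (Suc 0) l) * x ^ l" 0] p by simp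
qed (rule has_sum_row)

text \<open>The term at l = 0 is 1, the term at l = 1 vanishes by parity, and the terms from l = 2
  on form row \<open>k\<close> scaled by \<open>p * x^2\<close>.\<close>

lemma row_Suc_Suc: "row p x (Suc (Suc k)) = 1 + of_nat p * x\<^sup>2 * row p x k"
proof (rule has_sum_unique)
  let ?f = "\<lambda>l. of_real (coeff_pp p (Suc (Suc k)) l) * x ^ l"
  have "((\<lambda>l. ?f (Suc (Suc l))) has_sum of_nat p * x\<^sup>2 * row p x k) UNIV"
    using has_sum_cmult_right[OF has_sum_row[of k], of "of_nat p * x\<^sup>2"] p
    by (simp add: coeff_pp_Suc_Suc power2_eq_square mult_ac)
  from has_sum_nat_split2[OF this]
  show "(?f has_sum (1 + of_nat p * x\<^sup>2 * row p x k)) UNIV"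
    using p by simp
qed (rule has_sum_row)

end

section \<open>Summability of the triple series\<close>

context
  fixes p :: nat and x y z :: complex
  assumes p: "p > 0"
    and x: "norm (of_nat p * x) < 1" and y: "norm (of_nat p * y) < 1"
    and z: "norm (of_nat p * z) < 1"
begin

lemma has_sum_double_rows:
  "((\<lambda>(l, t). (of_real (coeff_pp p k l) * x ^ l) * (of_real (coeff_pp p k t) * z ^ t))
      has_sum row p x k * row p z k) UNIV"
  using has_sum_times_complex[OF has_sum_row[OF p x] has_sum_row[OF p z]]
  by (simp only: UNIV_Times_UNIV)

lemma summable_double_rows:
  "(\<lambda>(k, l, t). y ^ k *
      ((of_real (coeff_pp p k l) * x ^ l) * (of_real (coeff_pp p k t) * z ^ t))) summable_on UNIV"
proof -
  \<comment> \<open>The majorant is a product of three geometric series, in \<open>y\<close>,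
    \<open>p * x\<close> and \<open>p * z\<close>.\<close>
  define g where "g = (\<lambda>(k, l, t). y ^ k * ((of_nat p * x) ^ l * (of_nat p * z) ^ t))"
  have "((\<lambda>(k, u). y ^ k * (case u of (l, t) \<Rightarrow> (of_nat p * x) ^ l * (of_nat p * z) ^ t))
      has_sum 1 / (1 - y) * (1 / (1 - of_nat p * x) * (1 / (1 - of_nat p * z))))
      (UNIV \<times> UNIV \<times> UNIV)"
    by (intro has_sum_times_complex has_sum_geometric_complex norm_less_1[OF p y] x z)
  then have "(g has_sum 1 / (1 - y) * (1 / (1 - of_nat p * x) * (1 / (1 - of_nat p * z)))) UNIV"
    by (simp only: g_def case_prod_unfold UNIV_Times_UNIV)
  then have "(\<lambda>u. norm (g u)) summable_on UNIV"
    by (rule has_sum_complex_imp_norm_summable)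
  then have "(\<lambda>u. norm (case u of (k, l, t) \<Rightarrow> y ^ k *
      ((of_real (coeff_pp p k l) * x ^ l) * (of_real (coeff_pp p k t) * z ^ t)))) summable_on UNIV"
  proof (rule Infinite_Sum.abs_summable_on_comparison_test')
    fix u :: "nat \<times> nat \<times> nat"
    obtain k l t where u: "u = (k, l, t)" by (cases u)
    have "norm (of_real (coeff_pp p k l) * x ^ l) * norm (of_real (coeff_pp p k t) * z ^ t)
        \<le> norm ((of_nat p * x) ^ l) * norm ((of_nat p * z) ^ t)"
      by (intro mult_mono norm_coeff_pp_power_le p) auto
    then show "norm (case u of (k, l, t) \<Rightarrow> y ^ k *
        ((of_real (coeff_pp p k l) * x ^ l) * (of_real (coeff_pp p k t) * z ^ t))) \<le> norm (g u)"
      unfolding u g_def by (simp only: prod.case norm_mult) (erule mult_left_mono, rule norm_ge_zero)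
  qed
  then show ?thesis by (rule abs_summable_summable)
qed

text \<open>Fubini: for fixed \<open>k\<close> the sum over \<open>l\<close> and \<open>t\<close>
  factors into two rows.\<close>

lemma has_sum_row_product:
  "((\<lambda>k. y ^ k * (row p x k * row p z k)) has_sum
      (\<Sum>\<^sub>\<infinity>(k, l, t). y ^ k *
        ((of_real (coeff_pp p k l) * x ^ l) * (of_real (coeff_pp p k t) * z ^ t)))) UNIV"
proof (rule has_sum_SigmaD)
  let ?f = "\<lambda>(k, l, t). y ^ k *
      ((of_real (coeff_pp p k l) * x ^ l) * (of_real (coeff_pp p k t) * z ^ t))"
  show "(?f has_sum infsum ?f UNIV) (UNIV \<times> UNIV)"
    using has_sum_infsum[OF summable_double_rows] by (simp only: UNIV_Times_UNIV)
  show "((\<lambda>u. ?f (k, u)) has_sum y ^ k * (row p x k * row p z k)) UNIV" for k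
    using has_sum_cmult_right[OF has_sum_double_rows, of "y ^ k"]
    by (simp only: case_prod_unfold fst_conv snd_conv)
qed

lemma summable_row_product: "(\<lambda>k. y ^ k * (row p x k * row p z k)) summable_on UNIV"
  by (rule has_sum_imp_summable[OF has_sum_row_product])

lemma has_sum_double_rows_y:
  "((\<lambda>(k, l, t). y ^ k *
      ((of_real (coeff_pp p k l) * x ^ l) * (of_real (coeff_pp p k t) * z ^ t)))
    has_sum (\<Sum>\<^sub>\<infinity>k. y ^ k * (row p x k * row p z k))) UNIV"
  unfolding infsumI[OF has_sum_row_product] by (rule has_sum_infsum[OF summable_double_rows])

end

section \<open>Linear equations from the shift in k\<close>

lemma row_at_0:
  assumes "p > 0"
  shows "row p 0 k = 1"
proof (rule has_sum_unique[OF has_sum_row])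
  show "((\<lambda>l. of_real (coeff_pp p k l) * 0 ^ l) has_sum (1::complex)) UNIV"
    using assms by (intro has_sum_finite_neutralI[of "{0}"]) auto
qed (use assms in auto)

lemma norm_power2_mult_less_1:
  fixes x y :: complex
  assumes "p > 0" "norm (of_nat p * x) < 1" "norm (of_nat p * y) < 1"
  shows "norm (of_nat p * x\<^sup>2 * y\<^sup>2) < 1"
proof -
  have "norm (of_nat p * x\<^sup>2 * y\<^sup>2) = norm (of_nat p * x) * (norm x * norm y ^ 2)"
    by (simp add: norm_mult norm_power power2_eq_square)
  also have "\<dots> \<le> norm (of_nat p * x) * 1"
    using norm_less_1[OF assms(1,2)] norm_less_1[OF assms(1,3)]
    by (intro mult_left_mono mult_le_one power_le_one) auto
  finally show ?thesis using assms by simp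
qed

lemma one_minus_nonzero: "norm (w :: complex) < 1 \<Longrightarrow> 1 - w \<noteq> 0"
  by auto

text \<open>Inserting the recursion for \<open>row\<close> into the terms from k = 2 on reproduces
  the series itself with factor \<open>p * x^2 * y^2\<close>, besides a geometric series in
  \<open>y\<close>.\<close>

lemma infsum_row:
  assumes p: "p > 0" and x: "norm (of_nat p * x) < 1" and y: "norm (of_nat p * y) < 1"
  shows "(\<lambda>k. y ^ k * row p x k) summable_on UNIV"
    and "(\<Sum>\<^sub>\<infinity>k. y ^ k * row p x k) * (1 - of_nat p * x\<^sup>2 * y\<^sup>2) =
           1 / (1 - x) + y + y\<^sup>2 / (1 - y)"
proof -
  show summable: "(\<lambda>k. y ^ k * row p x k) summable_on UNIV"
    \<comment> \<open>At z = 0 the second row is constantly 1, so the single series is a special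
      case of the product series.\<close>
    using summable_row_product[OF p x y, of 0] p by (simp add: row_at_0)
  define B where "B = (\<Sum>\<^sub>\<infinity>k. y ^ k * row p x k)"
  have B: "((\<lambda>k. y ^ k * row p x k) has_sum B) UNIV"
    unfolding B_def using summable by simp
  have "((\<lambda>k. y\<^sup>2 * y ^ k + of_nat p * x\<^sup>2 * y\<^sup>2 * (y ^ k * row p x k)) has_sum
      y\<^sup>2 * (1 / (1 - y)) + of_nat p * x\<^sup>2 * y\<^sup>2 * B) UNIV"
    by (intro has_sum_add has_sum_cmult_right B has_sum_geometric_complex norm_less_1[OF p y])
  then have "((\<lambda>k. y ^ Suc (Suc k) * row p x (Suc (Suc k))) has_sum
      y\<^sup>2 * (1 / (1 - y)) + of_nat p * x\<^sup>2 * y\<^sup>2 * B) UNIV"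
    by (simp add: row_Suc_Suc[OF p x] algebra_simps power2_eq_square)
  from has_sum_unique[OF B has_sum_nat_split2[OF this]]
  have "B = 1 / (1 - x) + y + (y\<^sup>2 * (1 / (1 - y)) + of_nat p * x\<^sup>2 * y\<^sup>2 * B)"
    by (simp add: row_0[OF p x] row_1[OF p x])
  then show "B * (1 - of_nat p * x\<^sup>2 * y\<^sup>2) = 1 / (1 - x) + y + y\<^sup>2 / (1 - y)"
    by (simp add: algebra_simps)
qed

text \<open>The product of the recursions for \<open>x\<close> and \<open>z\<close> expands into
  four terms: a constant, one multiple of each row, and a multiple of the product of the rows. They
  sum to a geometric series, \<open>B x\<close>, \<open>B z\<close> and the unknown series.\<close>

lemma infsum_row_product:
  assumes p: "p > 0" and x: "norm (of_nat p * x) < 1" and y: "norm (of_nat p * y) < 1"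
    and z: "norm (of_nat p * z) < 1"
  defines "B \<equiv> \<lambda>x. \<Sum>\<^sub>\<infinity>k. y ^ k * row p x k"
  shows "(\<Sum>\<^sub>\<infinity>k. y ^ k * (row p x k * row p z k)) * (1 - (of_nat p)\<^sup>2 * x\<^sup>2 * y\<^sup>2 * z\<^sup>2) =
    1 / ((1 - x) * (1 - z)) + y +
      y\<^sup>2 * (1 / (1 - y) + of_nat p * x\<^sup>2 * B x + of_nat p * z\<^sup>2 * B z)"
proof -
  define H where "H = (\<Sum>\<^sub>\<infinity>k. y ^ k * (row p x k * row p z k))"
  have H: "((\<lambda>k. y ^ k * (row p x k * row p z k)) has_sum H) UNIV"
    unfolding H_def using summable_row_product[OF p x y z] by simp
  have B: "((\<lambda>k. y ^ k * row p w k) has_sum B w) UNIV" if "norm (of_nat p * w) < 1" for w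
    unfolding B_def using infsum_row(1)[OF p that y] by simp
  have "((\<lambda>k. y\<^sup>2 * (y ^ k + of_nat p * x\<^sup>2 * (y ^ k * row p x k) +
        of_nat p * z\<^sup>2 * (y ^ k * row p z k) +
        (of_nat p)\<^sup>2 * x\<^sup>2 * z\<^sup>2 * (y ^ k * (row p x k * row p z k)))) has_sum
      y\<^sup>2 * (1 / (1 - y) + of_nat p * x\<^sup>2 * B x + of_nat p * z\<^sup>2 * B z +
        (of_nat p)\<^sup>2 * x\<^sup>2 * z\<^sup>2 * H)) UNIV" (is "(_ has_sum ?S) _")
    by (intro has_sum_add has_sum_cmult_right B x z H has_sum_geometric_complex norm_less_1[OF p y])
  then have "((\<lambda>k. y ^ Suc (Suc k) * (row p x (Suc (Suc k)) * row p z (Suc (Suc k)))) has_sum ?S) UNIV"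
    by (simp add: row_Suc_Suc[OF p x] row_Suc_Suc[OF p z] algebra_simps power2_eq_square)
  from has_sum_unique[OF H has_sum_nat_split2[OF this]]
  have "H = 1 / ((1 - x) * (1 - z)) + y + ?S"
    by (simp add: row_0[OF p x] row_1[OF p x] row_0[OF p z] row_1[OF p z])
  then show "H * (1 - (of_nat p)\<^sup>2 * x\<^sup>2 * y\<^sup>2 * z\<^sup>2) =
    1 / ((1 - x) * (1 - z)) + y +
      y\<^sup>2 * (1 / (1 - y) + of_nat p * x\<^sup>2 * B x + of_nat p * z\<^sup>2 * B z)"
    by (simp add: algebra_simps)
qed

section \<open>Solving the equations\<close>

text \<open>Pure algebra, cleared of denominators. The extra factor
  \<open>1 - P * x * y^2 * z\<close> on the right is the one that the divisor sum later
  cancels.\<close>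

lemma f_A3_identity:
  fixes x y z P H B C :: complex
  assumes nz: "1 - x \<noteq> 0" "1 - y \<noteq> 0" "1 - z \<noteq> 0"
    and B: "B * (1 - P * x\<^sup>2 * y\<^sup>2) = 1 / (1 - x) + y + y\<^sup>2 / (1 - y)"
    and C: "C * (1 - P * z\<^sup>2 * y\<^sup>2) = 1 / (1 - z) + y + y\<^sup>2 / (1 - y)"
    and H: "H * (1 - P\<^sup>2 * x\<^sup>2 * y\<^sup>2 * z\<^sup>2) =
      1 / ((1 - x) * (1 - z)) + y + y\<^sup>2 * (1 / (1 - y) + P * x\<^sup>2 * B + P * z\<^sup>2 * C)"
  shows "H * ((1 - x) * (1 - y) * (1 - z) * (1 - P * y\<^sup>2 * z\<^sup>2) * (1 - P * y\<^sup>2 * x\<^sup>2)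
      * (1 - P\<^sup>2 * x\<^sup>2 * y\<^sup>2 * z\<^sup>2)) =
    (1 - P * x * y\<^sup>2 * z) *
    (1 - x * y - y * z + x * y * z + P * x * y^2 * z - P * x^2 * y^2 * z - P * x * y^2 * z^2
        + P * x^2 * y^3 * z^2)"
proof -
  \<comment> \<open>Naming the reciprocals leaves only polynomial identities modulo the relations
    \<open>XYZ\<close>.\<close>
  define X Y Z where "X = 1 / (1 - x)" and "Y = 1 / (1 - y)" and "Z = 1 / (1 - z)"
  have XYZ: "X * (1 - x) = 1" "Y * (1 - y) = 1" "Z * (1 - z) = 1"
    using nz by (auto simp: X_def Y_def Z_def)
  have B': "B * (1 - P * x\<^sup>2 * y\<^sup>2) = X + y + y\<^sup>2 * Y"
    and C': "C * (1 - P * z\<^sup>2 * y\<^sup>2) = Z + y + y\<^sup>2 * Y"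
    and H': "H * (1 - P\<^sup>2 * x\<^sup>2 * y\<^sup>2 * z\<^sup>2) =
      X * Z + y + y\<^sup>2 * (Y + P * x\<^sup>2 * B + P * z\<^sup>2 * C)"
    using B C H by (auto simp: X_def Y_def Z_def)
  have B'': "B * (1 - P * x\<^sup>2 * y\<^sup>2) * (1 - x) * (1 - y) = 1 - x * y"
  proof -
    have "B * (1 - P * x\<^sup>2 * y\<^sup>2) * (1 - x) * (1 - y) =
        (X * (1 - x)) * (1 - y) + y * (1 - x) * (1 - y) + y\<^sup>2 * (1 - x) * (Y * (1 - y))"
      unfolding B' by (simp add: algebra_simps)
    then show ?thesis unfolding XYZ by (simp add: algebra_simps power2_eq_square)
  qed
  have C'': "C * (1 - P * z\<^sup>2 * y\<^sup>2) * (1 - z) * (1 - y) = 1 - z * y"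
  proof -
    have "C * (1 - P * z\<^sup>2 * y\<^sup>2) * (1 - z) * (1 - y) =
        (Z * (1 - z)) * (1 - y) + y * (1 - z) * (1 - y) + y\<^sup>2 * (1 - z) * (Y * (1 - y))"
      unfolding C' by (simp add: algebra_simps)
    then show ?thesis unfolding XYZ by (simp add: algebra_simps power2_eq_square)
  qed
  \<comment> \<open>The relations \<open>qrw\<close> between these three monomials are what makes
    the factor \<open>1 - w\<close> split off.\<close>
  define q r w where "q = P * x\<^sup>2 * y\<^sup>2" and "r = P * z\<^sup>2 * y\<^sup>2" and "w = P * x * y\<^sup>2 * z"
  have qrw: "q * z = w * x" "r * x = w * z" "q * r = w * w"
    by (simp_all add: q_def r_def w_def power2_eq_square)
  \<comment> \<open>Variables stand for the five denominator factors, so that each can be grouped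
    with its reciprocal or with \<open>B\<close> or \<open>C\<close> without being multiplied
    out.\<close>
  have expand: "(X * Z + y + y\<^sup>2 * (Y + P * x\<^sup>2 * B + P * z\<^sup>2 * C)) * (a * b * c * u * v) =
      (X * a) * (Z * c) * b * u * v + y * a * b * c * u * v + y\<^sup>2 * (Y * b) * a * c * u * v
      + y\<^sup>2 * P * x\<^sup>2 * (B * u * a * b) * c * v + y\<^sup>2 * P * z\<^sup>2 * (C * v * c * b) * a * u"
    for a b c u v :: complex
    by (simp add: algebra_simps)
  let ?u = "1 - P * x\<^sup>2 * y\<^sup>2" and ?v = "1 - P * z\<^sup>2 * y\<^sup>2"
  have "H * ((1 - x) * (1 - y) * (1 - z) * (1 - P * y\<^sup>2 * z\<^sup>2) * (1 - P * y\<^sup>2 * x\<^sup>2)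
      * (1 - P\<^sup>2 * x\<^sup>2 * y\<^sup>2 * z\<^sup>2)) =
    H * (1 - P\<^sup>2 * x\<^sup>2 * y\<^sup>2 * z\<^sup>2) * ((1 - x) * (1 - y) * (1 - z) * ?u * ?v)"
    by (simp add: mult_ac)
  also have "\<dots> = (X * (1 - x)) * (Z * (1 - z)) * (1 - y) * ?u * ?v
      + y * (1 - x) * (1 - y) * (1 - z) * ?u * ?v
      + y\<^sup>2 * (Y * (1 - y)) * (1 - x) * (1 - z) * ?u * ?v
      + y\<^sup>2 * P * x\<^sup>2 * (B * ?u * (1 - x) * (1 - y)) * (1 - z) * ?v
      + y\<^sup>2 * P * z\<^sup>2 * (C * ?v * (1 - z) * (1 - y)) * (1 - x) * ?u"
    unfolding H' by (rule expand)
  also have "\<dots> = (1 - y) * ?u * ?v + y * (1 - x) * (1 - y) * (1 - z) * ?u * ?v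
      + y\<^sup>2 * (1 - x) * (1 - z) * ?u * ?v
      + y\<^sup>2 * P * x\<^sup>2 * (1 - x * y) * (1 - z) * ?v
      + y\<^sup>2 * P * z\<^sup>2 * (1 - z * y) * (1 - x) * ?u"
    unfolding XYZ B'' C'' by simp
  also have "\<dots> = (1 - y) * (1 - q) * (1 - r) + y * (1 - x) * (1 - y) * (1 - z) * (1 - q) * (1 - r)
      + y\<^sup>2 * (1 - x) * (1 - z) * (1 - q) * (1 - r)
      + q * (1 - x * y) * (1 - z) * (1 - r) + r * (1 - z * y) * (1 - x) * (1 - q)"
    unfolding q_def r_def by (simp only: mult_ac)
  \<comment> \<open>Now \<open>q\<close> and \<open>r\<close> enter only through
    \<open>q * z + r * x\<close> and \<open>q * r\<close>, which \<open>qrw\<close> turns into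
    \<open>w * (x + z)\<close> and \<open>w * w\<close>.\<close>
  also have "\<dots> = 1 - x * y - y * z + x * y * z + (y - 1) * (q * z + r * x)
      - (1 - x - z + x * y * z) * (q * r)"
    by (simp add: algebra_simps power2_eq_square)
  also have "\<dots> = (1 - w) * (1 - x * y - y * z + x * y * z + w * (1 - x - z + x * y * z))"
    unfolding qrw by (simp add: algebra_simps)
  also have "\<dots> = (1 - P * x * y\<^sup>2 * z) *
    (1 - x * y - y * z + x * y * z + P * x * y^2 * z - P * x^2 * y^2 * z - P * x * y^2 * z^2
        + P * x^2 * y^3 * z^2)"
    unfolding w_def by (simp add: algebra_simps power2_eq_square power3_eq_cube)
  finally show ?thesis .
qed

text \<open>Within the polydisc no denominator vanishes, so the identity can be divided out. The
  norm bound is recorded as well, for the geometric series over the divisors.\<close>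

lemma f_A3_eq:
  assumes p: "p > 0" and x: "norm (of_nat p * x) < 1" and y: "norm (of_nat p * y) < 1"
    and z: "norm (of_nat p * z) < 1"
  shows "1 / (1 - of_nat p * x * y\<^sup>2 * z) * (\<Sum>\<^sub>\<infinity>k. y ^ k * (row p x k * row p z k)) =
    f_A3 p x y z" and "norm (of_nat p * x * y\<^sup>2 * z) < 1"
proof -
  note less_1 = norm_less_1[OF p x] norm_less_1[OF p y] norm_less_1[OF p z]
  have "norm (of_nat p * x * y\<^sup>2 * z) = norm (of_nat p * x) * (norm y ^ 2 * norm z)"
    by (simp add: norm_mult norm_power)
  also have "\<dots> \<le> norm (of_nat p * x) * 1"
    using less_1 by (intro mult_left_mono mult_le_one power_le_one) auto
  finally show w: "norm (of_nat p * x * y\<^sup>2 * z) < 1"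
    using x by simp
  have "norm ((of_nat p)\<^sup>2 * x\<^sup>2 * y\<^sup>2 * z\<^sup>2) =
      norm (of_nat p * x * y\<^sup>2 * z) * (norm (of_nat p * x) * norm z)"
    by (simp add: norm_mult norm_power power2_eq_square)
  also have "\<dots> \<le> norm (of_nat p * x * y\<^sup>2 * z) * 1"
    using less_1 x by (intro mult_left_mono mult_le_one) auto
  finally have xyz: "norm ((of_nat p)\<^sup>2 * x\<^sup>2 * y\<^sup>2 * z\<^sup>2) < 1"
    using w by simp
  note nz = less_1[THEN one_minus_nonzero] w[THEN one_minus_nonzero] xyz[THEN one_minus_nonzero]
    norm_power2_mult_less_1[OF p x y, THEN one_minus_nonzero]
    norm_power2_mult_less_1[OF p z y, THEN one_minus_nonzero]
  have "(\<Sum>\<^sub>\<infinity>k. y ^ k * (row p x k * row p z k)) *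
      ((1 - x) * (1 - y) * (1 - z) * (1 - of_nat p * y\<^sup>2 * z\<^sup>2) * (1 - of_nat p * y\<^sup>2 * x\<^sup>2)
        * (1 - (of_nat p)\<^sup>2 * x\<^sup>2 * y\<^sup>2 * z\<^sup>2)) =
    (1 - of_nat p * x * y\<^sup>2 * z) *
      (1 - x * y - y * z + x * y * z + of_nat p * x * y^2 * z - of_nat p * x^2 * y^2 * z
        - of_nat p * x * y^2 * z^2 + of_nat p * x^2 * y^3 * z^2)"
    by (intro f_A3_identity[OF _ _ _ infsum_row(2)[OF p x y] infsum_row(2)[OF p z y]
          infsum_row_product[OF p x y z]] nz)
  moreover have "1 - of_nat p * y\<^sup>2 * z\<^sup>2 \<noteq> 0" "1 - of_nat p * y\<^sup>2 * x\<^sup>2 \<noteq> 0"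
    using nz by (simp_all add: mult_ac)
  ultimately show "1 / (1 - of_nat p * x * y\<^sup>2 * z) *
      (\<Sum>\<^sub>\<infinity>k. y ^ k * (row p x k * row p z k)) = f_A3 p x y z"
    unfolding f_A3_def Let_def
    using nz by (subst eq_divide_eq) (simp add: divide_eq_eq mult_ac)
qed

section \<open>Restoring the divisor sum\<close>

text \<open>The divisor \<open>p ^ s\<close> shifts the exponents \<open>(k, l, t)\<close> by
  \<open>(2 * s, s, s)\<close> and has weight \<open>p ^ s\<close>. It thus contributes the
  \<open>s\<close>-th power of \<open>p * x * y^2 * z\<close>, and the whole sum is a geometric
  series times the series of row products.\<close>

lemma has_sum_coeff3_prime_powers:
  assumes "prime p" and x: "norm (of_nat p * x) < 1" and y: "norm (of_nat p * y) < 1"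
    and z: "norm (of_nat p * z) < 1"
  shows "((\<lambda>(k, l, t). of_real (coeff3 (int p ^ k) (p ^ l) (p ^ t)) * x ^ l * y ^ k * z ^ t)
    has_sum f_A3 p x y z) UNIV"
proof -
  have p: "p > 0"
    using assms(1) by (simp add: prime_gt_0_nat)
  define f where "f = (\<lambda>(k, l, t). y ^ k *
      ((of_real (coeff_pp p k l) * x ^ l) * (of_real (coeff_pp p k t) * z ^ t)))"
  define T where "T = (\<lambda>(k, l, t). {s :: nat. 2 * s \<le> k \<and> s \<le> l \<and> s \<le> t})"
  define h where "h = (\<lambda>((k, l, t), s). (of_nat p * x * y\<^sup>2 * z) ^ s * f (k - 2 * s, l - s, t - s))"
  have "((\<lambda>(s, u). (of_nat p * x * y\<^sup>2 * z) ^ s * f u) has_sum f_A3 p x y z) (UNIV \<times> UNIV)"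
    unfolding f_A3_eq(1)[OF p x y z, symmetric] f_def
    by (intro has_sum_times_complex has_sum_geometric_complex f_A3_eq(2) has_sum_double_rows_y
        p x y z)
  \<comment> \<open>Regroups by the total exponents. The constraints in \<open>T\<close> say exactly
    that the truncated subtractions are genuine, so that the two maps are inverse to each
    other.\<close>
  also have "?this \<longleftrightarrow> (h has_sum f_A3 p x y z) (Sigma UNIV T)"
    by (rule has_sum_reindex_bij_witness
        [where i = "\<lambda>((k, l, t), s). (s, (k - 2 * s, l - s, t - s))"
          and j = "\<lambda>(s, (k, l, t)). ((k + 2 * s, l + s, t + s), s)"])
       (auto simp: T_def h_def)
  finally show ?thesis
  proof (rule has_sum_SigmaD)
    fix u :: "nat \<times> nat \<times> nat"
    obtain k l t where u: "u = (k, l, t)" by (cases u)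
    have fin: "finite (T u)"
      by (rule finite_subset[of _ "{..l}"]) (auto simp: T_def u)
    have "h (u, s) = of_real (real p ^ s * coeff_pp p (k - 2 * s) (l - s) *
        coeff_pp p (k - 2 * s) (t - s)) * x ^ l * y ^ k * z ^ t" if "s \<in> T u" for s
    proof -
      \<comment> \<open>Writing the exponents as sums removes truncated subtraction, and the powers
        of \<open>x\<close>, \<open>y\<close> and \<open>z\<close> recombine.\<close>
      from that obtain k' l' t' where eq: "k = k' + 2 * s" "l = l' + s" "t = t' + s"
        by (auto simp: T_def u le_iff_add add.commute)
      show ?thesis
        by (simp add: h_def f_def u eq power_mult_distrib power_add mult_ac flip: power_mult)
    qed
    then have "(\<Sum>s\<in>T u. h (u, s)) =
        of_real (coeff3 (int p ^ k) (p ^ l) (p ^ t)) * x ^ l * y ^ k * z ^ t"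
      unfolding coeff3_prime_power[OF assms(1)]
      by (simp add: T_def u sum_distrib_right)
    then show "((\<lambda>s. h (u, s)) has_sum (case u of (k, l, t) \<Rightarrow>
        of_real (coeff3 (int p ^ k) (p ^ l) (p ^ t)) * x ^ l * y ^ k * z ^ t)) (T u)"
      using fin by (intro has_sum_finiteI) (simp_all add: u)
  qed
qed

theorem theorem4p4:
  shows "is_quadratic_A3_WMDS Z_WMDS coeff3"
proof -
  \<comment> \<open>Rescales the radius condition to the form used in the comparisons.\<close>
  have "norm (of_nat p * x :: complex) < 1" if "prime p" "norm x < 1 / real p" for p x
    using that prime_gt_0_nat[of p] by (simp add: norm_mult field_simps)
  then show ?thesis
    unfolding is_quadratic_A3_WMDS_def Z_WMDS_def
    by (intro conjI refl allI impI has_sum_coeff3_prime_powers)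
qed

end
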